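(* Let $x_0\in X$ and $s=(s_1,\dots,s_p)$ with $s_i=\frac{f_i(x_0)}{F_i(x_0)}$. Suppose that: (i) for all $i\in I$, $j\in J$, $k\in K$, the functions $f_i,F_i,g_j,h_k$ are locally Lipschitz continuous and regular in the sense of Clarke on $U$, and $f_i^{\circ\circ}(x;d)$, $g_j^{\circ\circ}(x;d)$, $h_k^{\circ\circ}(x;d)$ are finite for all $x\in U$, $d\in Z$; and each $F_i$ is Gâteaux differentiable on $U$ with Gâteaux derivative $F'_{i,G}$, and $F_i''(x;d)$ exists for all $x\in U$, $d\in Z$; (ii) $f-s\ast F$ and $g$ are second-order convex at $x_0$ with respect to $X$ and $h$ is second-order infine at $x_0$ with respect to $X$, with common directions $v\in D(x_0)$ and $w\in Z$; that is, for every $x\in X$ there exist $v\in D(x_0)\setminus\{0\}$ and $w\in Z\setminus\{0\}$ such that for all $i\in I$, $j\in J$, $k\in K$, $$(f_i-s_iF_i)(x)-(f_i-s_iF_i)(x_0)\ge(f_i-s_iF_i)^\circ(x_0;w)+\tfrac12(f_i-s_iF_i)^{\circ\circ}(x_0;v),$$ $$g_j(x)-g_j(x_0)\ge g_j^\circ(x_0;w)+\tfrac12g_j^{\circ\circ}(x_0;v),\qquad h_k(x)-h_k(x_0)=h_k^\circ(x_0;w)+\tfrac12h_k^{\circ\circ}(x_0;v);$$ (iii) there exist $\lambda\in\mathbb{R}^p_{++}$, $\mu\in\mathbb{R}^m_+$ and $\nu\in\mathbb{R}^l$ such that for all $v\in D(x_0)$ and $w\in Z$, $$\sum_{i=1}^p\lambda_i\big(f_i^\circ(x_0;w)-s_i\langle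 F'_{i,G}(x_0),w\rangle\big)+\sum_{j=1}^m\mu_jg_j^\circ(x_0;w)+\sum_{k=1}^l\nu_kh_k^\circ(x_0;w)=0,$$ $$\sum_{i=1}^p\lambda_i\big(f_i^{\circ\circ}(x_0;v)-s_iF_i''(x_0;v)\big)+\sum_{j=1}^m\mu_jg_j^{\circ\circ}(x_0;v)+\sum_{k=1}^l\nu_kh_k^{\circ\circ}(x_0;v)\ge0,$$ and $\sum_{j=1}^m\mu_jg_j(x_0)=0$. Then $x_0$ is a Pareto efficient solution of NMFP.
   Context: Setting. $Z$ is a real reflexive Banach space with dual $Z^*$ and pairing $\langle\cdot,\cdot\rangle$; $U\subseteq Z$ is nonempty and open; $f,F:Z\to\mathbb{R}^p$, $g:Z\to\mathbb{R}^m$, $h:Z\to\mathbb{R}^l$ have components $f_i,F_i$ ($i\in I=\{1,\dots,p\}$), $g_j$ ($j\in J=\{1,\dots,m\}$), $h_k$ ($k\in K=\{1,\dots,l\}$), and $F_i(x)>0$ for all $x\in U$, $i\in I$. NMFP is the problem of minimizing $\frac{f}{F}=(\frac{f_1}{F_1},\dots,\frac{f_p}{F_p})^\top$ over $X=\{x\in U: g_j(x)\le0\ \forall j\in J,\ h_k(x)=0\ \forall k\in K\}$. $f-s\ast F$ has components $f_i-s_iF_i$. $\mathbb{R}^n_+$ and $\mathbb{R}^n_{++}$ are the nonnegative and positive orthants. $x_0\in X$ is a Pareto efficient solution of NMFP if there is no $x\in X$ with $\frac{f_i(x)}{F_i(x)}\le\frac{f_i(x_0)}{F_i(x_0)}$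 for all $i\in I$ and strict inequality for at least one $i$. Derivatives. For $\vartheta:U\to\mathbb{R}$, $x\in U$, $v\in Z$: $\vartheta'(x;v)=\lim_{t\to0^+}\frac{\vartheta(x+tv)-\vartheta(x)}{t}$; $\vartheta$ is Gâteaux differentiable at $x$ with Gâteaux derivative $\vartheta'_G(x)\in Z^*$ if $\vartheta'(x;v)$ exists and equals $\langle\vartheta'_G(x),v\rangle$ for all $v\in Z$; $\vartheta^{\circ}(x;v)=\limsup_{y\to x,\,t\to0^+}\frac{\vartheta(y+tv)-\vartheta(y)}{t}$ (Clarke); $\vartheta$ is regular in the sense of Clarke at $x$ if $\vartheta'(x;v)$ exists and equals $\vartheta^\circ(x;v)$ for all $v\in Z$; $\vartheta''(x;v)=\lim_{t\to0^+}\frac{\vartheta(x+tv)-\vartheta(x)-t\vartheta'(x;v)}{\frac12t^2}$ if the limit exists; $\vartheta^{\circ\circ}(x;v)=\limsup_{t\to0^+}\frac{\vartheta(x+tv)-\vartheta(x)-t\vartheta^\circ(x;v)}{\frac12t^2}$ (Páles–Zeidan). Cones. The contingent cone of $X$ at $x_0\in X$ is $T(X,x_0)=\{d\in Z:\exists\,t_k\to0^+,\ d_k\to d,\ x_0+t_kd_k\in X\ \forall k\}$. With $J(x_0)=\{j\in J:g_j(x_0)=0\}$, the linearizing cone is $$C(Q,x_0)=\{d\in Z:\ (\tfrac{f_i}{F_i})^\circ(x_0;d)\le0\ \forall i\in I,\ g_j^\circ(x_0;d)\le0\ \forall j\in J(x_0),\ h_k^\circ(x_0;d)=0\ \forall k\in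 K\}$$ ($Q$ is only part of the notation), and $D(x_0)=T(X,x_0)\cap C(Q,x_0)$ is the set of critical points. *)

theory Defs
  imports "HOL-Analysis.Analysis"
begin

text \<open>Surjectivity of the canonical embedding of \<open>'a\<close> into its bidual.\<close>

definition reflexive_space :: "'a::real_normed_vector itself \<Rightarrow> bool" where
  "reflexive_space _ \<longleftrightarrow>
     (\<forall>\<Psi> :: ('a \<Rightarrow>\<^sub>L real) \<Rightarrow>\<^sub>L real. \<exists>x :: 'a. \<forall>\<phi>. blinfun_apply \<Psi> \<phi> = blinfun_apply \<phi> x)"

definition locally_lipschitz_on :: "'a::metric_space set \<Rightarrow> ('a \<Rightarrow> real) \<Rightarrow> bool" where
  "locally_lipschitz_on U \<theta> \<longleftrightarrow>
     (\<forall>x\<in>U. \<exists>e>0. \<exists>L. L-lipschitz_on (ball x e \<inter> U) \<theta>)"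

text \<open>Existence of a one-sided limit always means existence of a finite limit, whereas the two
  upper limits are extended-real valued.\<close>

definition has_dir_deriv :: "('a::real_normed_vector \<Rightarrow> real) \<Rightarrow> 'a \<Rightarrow> 'a \<Rightarrow> real \<Rightarrow> bool" where
  "has_dir_deriv \<theta> x v D \<longleftrightarrow>
     ((\<lambda>t. (\<theta> (x + t *\<^sub>R v) - \<theta> x) / t) \<longlongrightarrow> D) (at_right 0)"

definition dir_deriv :: "('a::real_normed_vector \<Rightarrow> real) \<Rightarrow> 'a \<Rightarrow> 'a \<Rightarrow> real" where
  "dir_deriv \<theta> x v = Lim (at_right 0) (\<lambda>t. (\<theta> (x + t *\<^sub>R v) - \<theta> x) / t)"

definition has_gateaux_deriv ::
    "('a::real_normed_vector \<Rightarrow> real) \<Rightarrow> 'a \<Rightarrow> ('a \<Rightarrow>\<^sub>L real) \<Rightarrow> bool" where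
  "has_gateaux_deriv \<theta> x G \<longleftrightarrow> (\<forall>v. has_dir_deriv \<theta> x v (blinfun_apply G v))"

text \<open>The base point \<open>y\<close> of the difference quotient may equal \<open>x\<close>, hence the filter \<open>nhds x\<close>.\<close>

definition clarke :: "('a::real_normed_vector \<Rightarrow> real) \<Rightarrow> 'a \<Rightarrow> 'a \<Rightarrow> ereal" where
  "clarke \<theta> x v =
     Limsup (nhds x \<times>\<^sub>F at_right 0) (\<lambda>(y, t). ereal ((\<theta> (y + t *\<^sub>R v) - \<theta> y) / t))"

definition clarke_regular :: "('a::real_normed_vector \<Rightarrow> real) \<Rightarrow> 'a \<Rightarrow> bool" where
  "clarke_regular \<theta> x \<longleftrightarrow> (\<forall>v. \<exists>D. has_dir_deriv \<theta> x v D \<and> clarke \<theta> x v = ereal D)"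

definition has_dir_deriv2 :: "('a::real_normed_vector \<Rightarrow> real) \<Rightarrow> 'a \<Rightarrow> 'a \<Rightarrow> real \<Rightarrow> bool" where
  "has_dir_deriv2 \<theta> x v D \<longleftrightarrow>
     (\<exists>D1. has_dir_deriv \<theta> x v D1) \<and>
     ((\<lambda>t. (\<theta> (x + t *\<^sub>R v) - \<theta> x - t * dir_deriv \<theta> x v) / (1/2 * t\<^sup>2)) \<longlongrightarrow> D) (at_right 0)"

definition dir_deriv2 :: "('a::real_normed_vector \<Rightarrow> real) \<Rightarrow> 'a \<Rightarrow> 'a \<Rightarrow> real" where
  "dir_deriv2 \<theta> x v =
     Lim (at_right 0) (\<lambda>t. (\<theta> (x + t *\<^sub>R v) - \<theta> x - t * dir_deriv \<theta> x v) / (1/2 * t\<^sup>2))"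

text \<open>The second-order upper directional derivative of Pales and Zeidan.  It is only meaningful
  where \<open>clarke \<theta> x v\<close> is finite, for instance for locally Lipschitz \<open>\<theta>\<close>.\<close>

definition pales_zeidan :: "('a::real_normed_vector \<Rightarrow> real) \<Rightarrow> 'a \<Rightarrow> 'a \<Rightarrow> ereal" where
  "pales_zeidan \<theta> x v =
     Limsup (at_right 0)
       (\<lambda>t. (ereal (\<theta> (x + t *\<^sub>R v) - \<theta> x) - ereal t * clarke \<theta> x v) / ereal (1/2 * t\<^sup>2))"

definition feasible ::
    "'a set \<Rightarrow> ('a \<Rightarrow> real^'m) \<Rightarrow> ('a \<Rightarrow> real^'l) \<Rightarrow> 'a set" where
  "feasible U g h = {x \<in> U. (\<forall>j. g x $ j \<le> 0) \<and> (\<forall>k. h x $ k = 0)}"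

definition pareto_efficient ::
    "'a set \<Rightarrow> ('a \<Rightarrow> real^'p) \<Rightarrow> ('a \<Rightarrow> real^'p) \<Rightarrow> ('a \<Rightarrow> real^'m) \<Rightarrow> ('a \<Rightarrow> real^'l) \<Rightarrow> 'a \<Rightarrow> bool" where
  "pareto_efficient U f F g h x0 \<longleftrightarrow>
     x0 \<in> feasible U g h \<and>
     \<not> (\<exists>x\<in>feasible U g h.
          (\<forall>i. f x $ i / F x $ i \<le> f x0 $ i / F x0 $ i) \<and>
          (\<exists>i. f x $ i / F x $ i < f x0 $ i / F x0 $ i))"

definition contingent_cone :: "'a::real_normed_vector set \<Rightarrow> 'a \<Rightarrow> 'a set" where
  "contingent_cone X x0 =
     {d. \<exists>t :: nat \<Rightarrow> real. \<exists>dd :: nat \<Rightarrow> 'a.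
           (\<forall>k. t k > 0) \<and> t \<longlonglongrightarrow> 0 \<and> dd \<longlonglongrightarrow> d \<and> (\<forall>k. x0 + t k *\<^sub>R dd k \<in> X)}"

definition linearizing_cone ::
    "('a::real_normed_vector \<Rightarrow> real^'p) \<Rightarrow> ('a \<Rightarrow> real^'p) \<Rightarrow> ('a \<Rightarrow> real^'m) \<Rightarrow> ('a \<Rightarrow> real^'l) \<Rightarrow> 'a
      \<Rightarrow> 'a set" where
  "linearizing_cone f F g h x0 =
     {d. (\<forall>i. clarke (\<lambda>x. f x $ i / F x $ i) x0 d \<le> 0) \<and>
         (\<forall>j. g x0 $ j = 0 \<longrightarrow> clarke (\<lambda>x. g x $ j) x0 d \<le> 0) \<and>
         (\<forall>k. clarke (\<lambda>x. h x $ k) x0 d = 0)}"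

definition critical_set ::
    "'a::real_normed_vector set \<Rightarrow> ('a \<Rightarrow> real^'p) \<Rightarrow> ('a \<Rightarrow> real^'p) \<Rightarrow> ('a \<Rightarrow> real^'m) \<Rightarrow> ('a \<Rightarrow> real^'l)
      \<Rightarrow> 'a \<Rightarrow> 'a set" where
  "critical_set U f F g h x0 =
     contingent_cone (feasible U g h) x0 \<inter> linearizing_cone f F g h x0"

end

theory Submission
  imports Defs
begin

text \<open>Regularity and Gateaux differentiability of \<open>F\<close> together make its Clarke difference quotient converge
  (strict differentiability), so both \<open>clarke\<close> and \<open>pales_zeidan\<close> of \<open>f - s F\<close> split exactly.  Weighting
  the second-order convexity inequalities with the multipliers and adding them up gives
  \<open>\<Sum> \<lambda>\<^sub>i (f\<^sub>i - s\<^sub>i F\<^sub>i)(x) \<ge> 0\<close> for every feasible \<open>x\<close>, while a point dominating \<open>x0\<close> would make this sum negative.\<close>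

text \<open>Eventually \<open>w\<close> stays below \<open>c + e\<close>. A real constant leaves the
  \<open>Limsup\<close> even where that of \<open>u\<close> is infinite, and \<open>e\<close> is
  arbitrary.\<close>

lemma Limsup_add_tendsto_le:
  fixes u w :: "'b \<Rightarrow> real"
  assumes "F \<noteq> bot" and w: "(w \<longlongrightarrow> c) F"
  shows "Limsup F (\<lambda>x. ereal (u x + w x)) \<le> Limsup F (\<lambda>x. ereal (u x)) + ereal c"
proof (rule ereal_le_epsilon2)
  fix e :: real assume "e > 0"
  have "\<forall>\<^sub>F x in F. w x < c + e"
    using w \<open>e > 0\<close> by (intro order_tendstoD) auto
  then have "Limsup F (\<lambda>x. ereal (u x + w x)) \<le> Limsup F (\<lambda>x. ereal (u x) + ereal (c + e))"
    by (intro Limsup_mono) (auto elim: eventually_mono)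
  also have "\<dots> = Limsup F (\<lambda>x. ereal (u x)) + ereal (c + e)"
    using assms(1) by (intro Limsup_add_ereal_right) auto
  also have "\<dots> = Limsup F (\<lambda>x. ereal (u x)) + ereal c + ereal e"
    by (simp add: add.assoc)
  finally show "Limsup F (\<lambda>x. ereal (u x + w x)) \<le> Limsup F (\<lambda>x. ereal (u x)) + ereal c + ereal e" .
qed

text \<open>Convergence of the subtracted term turns subadditivity into an equality: the one-sided
  bound is used once for \<open>u + (- w)\<close> and once for \<open>(u - w) + w\<close>. Both
  splittings of \<open>f - s F\<close> rest on this.\<close>

lemma Limsup_diff_tendsto:
  fixes u w :: "'b \<Rightarrow> real"
  assumes "F \<noteq> bot" and w: "(w \<longlongrightarrow> c) F"
  shows "Limsup F (\<lambda>x. ereal (u x - w x)) = Limsup F (\<lambda>x. ereal (u x)) - ereal c"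
proof (rule antisym)
  show "Limsup F (\<lambda>x. ereal (u x - w x)) \<le> Limsup F (\<lambda>x. ereal (u x)) - ereal c"
    using Limsup_add_tendsto_le[OF assms(1) tendsto_minus[OF w], of u]
    by (simp add: minus_ereal_def)
  have "Limsup F (\<lambda>x. ereal (u x)) \<le> Limsup F (\<lambda>x. ereal (u x - w x)) + ereal c"
    using Limsup_add_tendsto_le[OF assms, of "\<lambda>x. u x - w x"] by simp
  then show "Limsup F (\<lambda>x. ereal (u x)) - ereal c \<le> Limsup F (\<lambda>x. ereal (u x - w x))"
    by (simp add: ereal_minus_le_iff add.commute)
qed

lemma clarke_filter_neq_bot: "nhds (x::'a::real_normed_vector) \<times>\<^sub>F at_right (0::real) \<noteq> bot"
  by (simp add: prod_filter_eq_bot)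

text \<open>Replacing the base point \<open>y\<close> by \<open>y + t v\<close> turns the quotient in direction \<open>-v\<close> into the negative
  of the quotient in direction \<open>v\<close>, so \<open>clarke \<theta> x (-v)\<close> controls the lower limit.\<close>

lemma clarke_quotient_tendsto:
  fixes \<theta> :: "'a::real_normed_vector \<Rightarrow> real"
  assumes "clarke \<theta> x v = ereal D" and "clarke \<theta> x (- v) = ereal (- D)"
  shows "((\<lambda>(y, t). (\<theta> (y + t *\<^sub>R v) - \<theta> y) / t) \<longlongrightarrow> D) (nhds x \<times>\<^sub>F at_right 0)"
proof -
  let ?F = "nhds x \<times>\<^sub>F at_right (0::real)"
  let ?q = "\<lambda>v (y, t). ereal ((\<theta> (y + t *\<^sub>R v) - \<theta> y) / t)"
  let ?\<phi> = "\<lambda>(y, t). (y + t *\<^sub>R v, t)"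
  have snd: "filterlim snd (at_right 0) ?F" and fst: "filterlim fst (nhds x) ?F"
    by (rule filterlim_snd filterlim_fst)+
  \<comment> \<open>The shift \<open>t v\<close> vanishes with \<open>t\<close>, so the moved base
    point still tends to \<open>x\<close> and the substitution \<open>?\<phi>\<close> respects the
    filter.\<close>
  have "((\<lambda>p. fst p + snd p *\<^sub>R v) \<longlongrightarrow> x + 0 *\<^sub>R v) ?F"
    using fst snd by (intro tendsto_intros) (auto simp: filterlim_at)
  then have "filterlim ?\<phi> ?F ?F"
    using filterlim_Pair[OF _ snd, of "\<lambda>p. fst p + snd p *\<^sub>R v" "nhds x"]
    by (simp add: case_prod_unfold)
  then have le: "filtermap ?\<phi> ?F \<le> ?F"
    by (simp add: filterlim_def)
  have "- Liminf ?F (?q v) = Limsup ?F (\<lambda>p. - ?q v p)"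
    by (simp add: ereal_Limsup_uminus)
  also have "\<dots> = Limsup ?F (\<lambda>p. ?q (- v) (?\<phi> p))"
    by (rule arg_cong[where f = "Limsup ?F"]) (auto simp: fun_eq_iff divide_simps)
  also have "\<dots> \<le> Limsup (filtermap ?\<phi> ?F) (?q (- v))"
    by (rule Limsup_filtermap_ge)
  \<comment> \<open>The image filter is finer, so more upper bounds hold eventually and the infimum
    defining \<open>Limsup\<close> can only drop.\<close>
  also have "\<dots> \<le> Limsup ?F (?q (- v))"
    unfolding Limsup_def by (rule INF_superset_mono) (use le in \<open>auto simp: le_filter_def\<close>)
  also have "\<dots> = - ereal D"
    using assms(2) by (simp add: clarke_def)
  finally have "ereal D \<le> Liminf ?F (?q v)"
    by (simp add: ereal_uminus_le_reorder)
  moreover have "Liminf ?F (?q v) \<le> Limsup ?F (?q v)"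
    by (rule Liminf_le_Limsup) (rule clarke_filter_neq_bot)
  ultimately have "(?q v \<longlongrightarrow> ereal D) ?F"
    using assms(1) clarke_filter_neq_bot[of x]
    by (auto simp: tendsto_iff_Liminf_eq_Limsup clarke_def)
  then show ?thesis
    by (simp add: case_prod_unfold)
qed

lemma clarke_regularD:
  assumes "clarke_regular \<theta> x" and "has_dir_deriv \<theta> x v D"
  shows "clarke \<theta> x v = ereal D"
proof -
  obtain D' where "has_dir_deriv \<theta> x v D'" "clarke \<theta> x v = ereal D'"
    using assms(1) by (auto simp: clarke_regular_def)
  then show ?thesis
    using assms(2) tendsto_unique[OF trivial_limit_at_right_real]
    unfolding has_dir_deriv_def by metis
qed

text \<open>The quotient of \<open>F\<close> converges over the joint filter in \<open>y\<close> and
  \<open>t\<close>, so it can be subtracted exactly. As \<open>s\<close> may have either sign,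
  sublinearity of the Clarke derivative would give only an inequality.\<close>

lemma clarke_diff_scale:
  assumes reg: "clarke_regular F x" and G: "has_gateaux_deriv F x G"
  shows "clarke (\<lambda>y. f y - s * F y) x v = clarke f x v - ereal (s * blinfun_apply G v)"
proof -
  \<comment> \<open>Stated for every direction: linearity of \<open>G\<close> then supplies the
    opposite values at \<open>v\<close> and \<open>-v\<close> that force convergence.\<close>
  have "clarke F x v = ereal (blinfun_apply G v)" for v
    using clarke_regularD[OF reg] G by (simp add: has_gateaux_deriv_def)
  then have lim: "((\<lambda>(y, t). (F (y + t *\<^sub>R v) - F y) / t) \<longlongrightarrow> blinfun_apply G v) (nhds x \<times>\<^sub>F at_right 0)"
    by (intro clarke_quotient_tendsto) (simp_all add: blinfun.minus_right)
  have quot: "(f z - s * F z - (f y - s * F y)) / t = (f z - f y) / t - s * ((F z - F y) / t)" for y z t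
    by (simp add: diff_divide_distrib[symmetric] algebra_simps)
  from Limsup_diff_tendsto[OF clarke_filter_neq_bot tendsto_mult_left[OF lim, of s],
      of "\<lambda>(y, t). (f (y + t *\<^sub>R v) - f y) / t"]
  have "Limsup (nhds x \<times>\<^sub>F at_right 0) (\<lambda>p. ereal (((f (fst p + snd p *\<^sub>R v) - f (fst p)) / snd p)
        - s * ((F (fst p + snd p *\<^sub>R v) - F (fst p)) / snd p)))
      = clarke f x v - ereal (s * blinfun_apply G v)"
    by (simp only: clarke_def case_prod_unfold)
  then show ?thesis
    by (simp only: clarke_def case_prod_unfold quot)
qed

text \<open>A finite Clarke value and \<open>t > 0\<close> reduce the extended-real quotient to a
  real one, the form that \<open>Limsup_diff_tendsto\<close> handles.\<close>

lemma pales_zeidan_eq_Limsup: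
  assumes "clarke \<theta> x v = ereal D"
  shows "pales_zeidan \<theta> x v =
    Limsup (at_right 0) (\<lambda>t. ereal ((\<theta> (x + t *\<^sub>R v) - \<theta> x - t * D) / (1/2 * t\<^sup>2)))"
  unfolding pales_zeidan_def assms
  by (rule Limsup_eq) (auto simp: eventually_at_filter)

text \<open>Since the first-order term splits exactly, the second-order quotient is that of
  \<open>f\<close> minus \<open>s\<close> times that of \<open>F\<close>, and the latter
  converges.\<close>

lemma pales_zeidan_diff_scale:
  assumes f: "clarke f x v = ereal C"
    and reg: "clarke_regular F x" and G: "has_gateaux_deriv F x G"
    and F2: "has_dir_deriv2 F x v D"
  shows "pales_zeidan (\<lambda>y. f y - s * F y) x v = pales_zeidan f x v - ereal (s * dir_deriv2 F x v)"
proof -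
  let ?r = "\<lambda>\<theta> D t. (\<theta> (x + t *\<^sub>R v) - \<theta> x - t * D) / (1/2 * t\<^sup>2)"
  \<comment> \<open>The splitting of the Clarke term produces \<open>G v\<close>, whereas
    \<open>has_dir_deriv2\<close> is phrased with \<open>dir_deriv\<close>; the two must agree for
    the quotients to match.\<close>
  have "dir_deriv F x v = blinfun_apply G v"
    using G unfolding dir_deriv_def has_gateaux_deriv_def has_dir_deriv_def
    by (intro tendsto_Lim) auto
  moreover have "dir_deriv2 F x v = D"
    using F2 unfolding dir_deriv2_def has_dir_deriv2_def by (intro tendsto_Lim) auto
  ultimately have lim: "(?r F (blinfun_apply G v) \<longlongrightarrow> dir_deriv2 F x v) (at_right 0)"
    using F2 by (simp add: has_dir_deriv2_def)
  have "clarke (\<lambda>y. f y - s * F y) x v = ereal (C - s * blinfun_apply G v)"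
    using clarke_diff_scale[OF reg G] f by simp
  from pales_zeidan_eq_Limsup[OF this]
  have "pales_zeidan (\<lambda>y. f y - s * F y) x v =
      Limsup (at_right 0) (\<lambda>t. ereal (?r f C t - s * ?r F (blinfun_apply G v) t))"
    by (simp add: diff_divide_distrib[symmetric] algebra_simps)
  also have "\<dots> = Limsup (at_right 0) (\<lambda>t. ereal (?r f C t)) - ereal (s * dir_deriv2 F x v)"
    by (rule Limsup_diff_tendsto[OF trivial_limit_at_right_real tendsto_mult_left[OF lim]])
  finally show ?thesis
    by (simp add: pales_zeidan_eq_Limsup[OF f])
qed

theorem theorem4p1:
  fixes U :: "'a::banach set"
    and f F :: "'a \<Rightarrow> real^'p"
    and g :: "'a \<Rightarrow> real^'m"
    and h :: "'a \<Rightarrow> real^'l"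
    and F' :: "'p \<Rightarrow> 'a \<Rightarrow> ('a \<Rightarrow>\<^sub>L real)"
    and x0 :: 'a
    and s :: "real^'p"
  assumes "reflexive_space TYPE('a)"
    and "open U" and "U \<noteq> {}"
    and "\<forall>x\<in>U. \<forall>i. F x $ i > 0"
    and "x0 \<in> feasible U g h"
    and "\<forall>i. s $ i = f x0 $ i / F x0 $ i"
    (* (i) *)
    and "\<forall>i. locally_lipschitz_on U (\<lambda>x. f x $ i)"
    and "\<forall>i. locally_lipschitz_on U (\<lambda>x. F x $ i)"
    and "\<forall>j. locally_lipschitz_on U (\<lambda>x. g x $ j)"
    and "\<forall>k. locally_lipschitz_on U (\<lambda>x. h x $ k)"
    and "\<forall>i. \<forall>x\<in>U. clarke_regular (\<lambda>x. f x $ i) x"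
    and "\<forall>i. \<forall>x\<in>U. clarke_regular (\<lambda>x. F x $ i) x"
    and "\<forall>j. \<forall>x\<in>U. clarke_regular (\<lambda>x. g x $ j) x"
    and "\<forall>k. \<forall>x\<in>U. clarke_regular (\<lambda>x. h x $ k) x"
    and "\<forall>i. \<forall>x\<in>U. \<forall>d. \<bar>pales_zeidan (\<lambda>x. f x $ i) x d\<bar> \<noteq> \<infinity>"
    and "\<forall>j. \<forall>x\<in>U. \<forall>d. \<bar>pales_zeidan (\<lambda>x. g x $ j) x d\<bar> \<noteq> \<infinity>"
    and "\<forall>k. \<forall>x\<in>U. \<forall>d. \<bar>pales_zeidan (\<lambda>x. h x $ k) x d\<bar> \<noteq> \<infinity>"
    and "\<forall>i. \<forall>x\<in>U. has_gateaux_deriv (\<lambda>x. F x $ i) x (F' i x)"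
    and "\<forall>i. \<forall>x\<in>U. \<forall>d. \<exists>D. has_dir_deriv2 (\<lambda>x. F x $ i) x d D"
    (* (ii) *)
    and "\<forall>x\<in>feasible U g h. \<exists>v\<in>critical_set U f F g h x0 - {0}. \<exists>w. w \<noteq> 0 \<and>
           (\<forall>i. ereal ((f x $ i - s $ i * F x $ i) - (f x0 $ i - s $ i * F x0 $ i))
                  \<ge> clarke (\<lambda>y. f y $ i - s $ i * F y $ i) x0 w
                    + 1/2 * pales_zeidan (\<lambda>y. f y $ i - s $ i * F y $ i) x0 v) \<and>
           (\<forall>j. ereal (g x $ j - g x0 $ j)
                  \<ge> clarke (\<lambda>y. g y $ j) x0 w + 1/2 * pales_zeidan (\<lambda>y. g y $ j) x0 v) \<and>
           (\<forall>k. ereal (h x $ k - h x0 $ k)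
                  = clarke (\<lambda>y. h y $ k) x0 w + 1/2 * pales_zeidan (\<lambda>y. h y $ k) x0 v)"
    (* (iii) *)
    and "\<exists>(lam :: real^'p) (\<mu> :: real^'m) (\<nu> :: real^'l).
           (\<forall>i. lam $ i > 0) \<and> (\<forall>j. \<mu> $ j \<ge> 0) \<and>
           (\<forall>v\<in>critical_set U f F g h x0. \<forall>w.
              (\<Sum>i\<in>UNIV. ereal (lam $ i) *
                   (clarke (\<lambda>y. f y $ i) x0 w - ereal (s $ i * blinfun_apply (F' i x0) w)))
              + (\<Sum>j\<in>UNIV. ereal (\<mu> $ j) * clarke (\<lambda>y. g y $ j) x0 w)
              + (\<Sum>k\<in>UNIV. ereal (\<nu> $ k) * clarke (\<lambda>y. h y $ k) x0 w) = 0 \<and>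
              (\<Sum>i\<in>UNIV. ereal (lam $ i) *
                   (pales_zeidan (\<lambda>y. f y $ i) x0 v
                    - ereal (s $ i * dir_deriv2 (\<lambda>y. F y $ i) x0 v)))
              + (\<Sum>j\<in>UNIV. ereal (\<mu> $ j) * pales_zeidan (\<lambda>y. g y $ j) x0 v)
              + (\<Sum>k\<in>UNIV. ereal (\<nu> $ k) * pales_zeidan (\<lambda>y. h y $ k) x0 v) \<ge> 0) \<and>
           (\<Sum>j\<in>UNIV. \<mu> $ j * g x0 $ j) = 0"
  shows "pareto_efficient U f F g h x0"
proof -
  note pos = assms(4) and feas = assms(5) and s = assms(6)
    and reg_f = assms(11) and reg_F = assms(12) and reg_g = assms(13) and reg_h = assms(14)
    and fin_f = assms(15) and fin_g = assms(16) and fin_h = assms(17)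
    and gat = assms(18) and F2 = assms(19) and convex = assms(20) and multipliers = assms(21)
  have U: "x0 \<in> U"
    using feas by (simp add: feasible_def)
  have fin: "\<bar>clarke \<theta> x v\<bar> \<noteq> \<infinity>" if "clarke_regular \<theta> x" for \<theta> :: "'a \<Rightarrow> real" and x v
    using spec[OF that[unfolded clarke_regular_def], of v] by auto
  \<comment> \<open>All derivatives involved are finite, so real-valued copies allow the later sums
    to be rearranged without extended-real side conditions.\<close>
  define cf where "cf i w = real_of_ereal (clarke (\<lambda>y. f y $ i) x0 w)" for i w
  define cg where "cg j w = real_of_ereal (clarke (\<lambda>y. g y $ j) x0 w)" for j w
  define ch where "ch k w = real_of_ereal (clarke (\<lambda>y. h y $ k) x0 w)" for k w
  define pf where "pf i v = real_of_ereal (pales_zeidan (\<lambda>y. f y $ i) x0 v)" for i v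
  define pg where "pg j v = real_of_ereal (pales_zeidan (\<lambda>y. g y $ j) x0 v)" for j v
  define ph where "ph k v = real_of_ereal (pales_zeidan (\<lambda>y. h y $ k) x0 v)" for k v
  have cf: "clarke (\<lambda>y. f y $ i) x0 w = ereal (cf i w)" for i w
    using reg_f U by (simp add: cf_def ereal_real' fin)
  have cg: "clarke (\<lambda>y. g y $ j) x0 w = ereal (cg j w)" for j w
    using reg_g U by (simp add: cg_def ereal_real' fin)
  have ch: "clarke (\<lambda>y. h y $ k) x0 w = ereal (ch k w)" for k w
    using reg_h U by (simp add: ch_def ereal_real' fin)
  have pf: "pales_zeidan (\<lambda>y. f y $ i) x0 v = ereal (pf i v)" for i v
    using fin_f U by (simp add: pf_def ereal_real')
  have pg: "pales_zeidan (\<lambda>y. g y $ j) x0 v = ereal (pg j v)" for j v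
    using fin_g U by (simp add: pg_def ereal_real')
  have ph: "pales_zeidan (\<lambda>y. h y $ k) x0 v = ereal (ph k v)" for k v
    using fin_h U by (simp add: ph_def ereal_real')
  \<comment> \<open>These numbers link the two conditions: the splitting lemmas identify them with
    the derivatives of \<open>f - s F\<close> in the convexity inequalities, and they are the
    brackets in the multiplier conditions.\<close>
  define CF where "CF i w = cf i w - s $ i * blinfun_apply (F' i x0) w" for i w
  define PF where "PF i v = pf i v - s $ i * dir_deriv2 (\<lambda>y. F y $ i) x0 v" for i v
  have CF: "clarke (\<lambda>y. f y $ i - s $ i * F y $ i) x0 w = ereal (CF i w)" for i w
    using clarke_diff_scale[of "\<lambda>y. F y $ i" x0 "F' i x0" "\<lambda>y. f y $ i" "s $ i" w] reg_F gat U
    by (simp add: cf CF_def)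
  have PF: "pales_zeidan (\<lambda>y. f y $ i - s $ i * F y $ i) x0 v = ereal (PF i v)" for i v
  proof -
    obtain D where "has_dir_deriv2 (\<lambda>y. F y $ i) x0 v D"
      using F2 U by blast
    then show ?thesis
      using pales_zeidan_diff_scale[OF cf, of "\<lambda>y. F y $ i" "F' i x0" v D i "s $ i"] reg_F gat U
      by (simp add: pf PF_def)
  qed
  have half: "1/2 * ereal r = ereal (r / 2)" for r
    by (simp add: one_ereal_def)
  obtain lam :: "real^'p" and \<mu> :: "real^'m" and \<nu> :: "real^'l" where
    lam: "\<And>i. lam $ i > 0" and \<mu>: "\<And>j. \<mu> $ j \<ge> 0" and
    first: "\<And>v w. v \<in> critical_set U f F g h x0 \<Longrightarrow>
      (\<Sum>i\<in>UNIV. lam $ i * CF i w) + (\<Sum>j\<in>UNIV. \<mu> $ j * cg j w) + (\<Sum>k\<in>UNIV. \<nu> $ k * ch k w) = 0" and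
    second: "\<And>v. v \<in> critical_set U f F g h x0 \<Longrightarrow>
      (\<Sum>i\<in>UNIV. lam $ i * PF i v) + (\<Sum>j\<in>UNIV. \<mu> $ j * pg j v) + (\<Sum>k\<in>UNIV. \<nu> $ k * ph k v) \<ge> 0" and
    compl: "(\<Sum>j\<in>UNIV. \<mu> $ j * g x0 $ j) = 0"
    using multipliers unfolding cf cg ch pf pg ph
    by (simp add: CF_def PF_def) blast
  have F_pos: "F x $ i > 0" if "x \<in> U" for x i
    using pos that by blast
  \<comment> \<open>The parameter \<open>s\<close> is the value of the ratio at \<open>x0\<close>,
    so every parametric objective vanishes there.\<close>
  have base: "f x0 $ i - s $ i * F x0 $ i = 0" for i
    using F_pos[OF U, of i] s by simp
  have False if x: "x \<in> feasible U g h"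
    and le: "\<And>i. f x $ i / F x $ i \<le> f x0 $ i / F x0 $ i"
    and less: "f x $ i0 / F x $ i0 < f x0 $ i0 / F x0 $ i0" for x i0
  proof -
    have xU: "x \<in> U" and gx: "\<And>j. g x $ j \<le> 0" and hx: "\<And>k. h x $ k = 0"
      and hx0: "\<And>k. h x0 $ k = 0"
      using x feas by (auto simp: feasible_def)
    obtain v w where v: "v \<in> critical_set U f F g h x0"
      and cvf: "\<And>i. f x $ i - s $ i * F x $ i \<ge> CF i w + PF i v / 2"
      and cvg: "\<And>j. g x $ j - g x0 $ j \<ge> cg j w + pg j v / 2"
      and cvh: "\<And>k. h x $ k - h x0 $ k = ch k w + ph k v / 2"
      using bspec[OF convex x] by (auto simp: CF PF cg pg ch ph half base)
    \<comment> \<open>The first multiplier condition plus half of the second; the factor 1/2 is the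
      one in the second-order convexity inequalities.\<close>
    have "0 \<le> ((\<Sum>i\<in>UNIV. lam $ i * CF i w) + (\<Sum>j\<in>UNIV. \<mu> $ j * cg j w) + (\<Sum>k\<in>UNIV. \<nu> $ k * ch k w))
        + ((\<Sum>i\<in>UNIV. lam $ i * PF i v) + (\<Sum>j\<in>UNIV. \<mu> $ j * pg j v) + (\<Sum>k\<in>UNIV. \<nu> $ k * ph k v)) / 2"
      using first[OF v] second[OF v] by simp
    also have "\<dots> = (\<Sum>i\<in>UNIV. lam $ i * (CF i w + PF i v / 2))
        + (\<Sum>j\<in>UNIV. \<mu> $ j * (cg j w + pg j v / 2)) + (\<Sum>k\<in>UNIV. \<nu> $ k * (ch k w + ph k v / 2))"
      by (simp add: sum.distrib distrib_left sum_divide_distrib add_divide_distrib)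
    \<comment> \<open>Convexity is weighted by the nonnegative \<open>lam\<close> and
      \<open>\<mu>\<close>; for \<open>h\<close> there is equality, so the sign of
      \<open>\<nu>\<close> is free.\<close>
    also have "\<dots> \<le> (\<Sum>i\<in>UNIV. lam $ i * (f x $ i - s $ i * F x $ i))
        + (\<Sum>j\<in>UNIV. \<mu> $ j * (g x $ j - g x0 $ j)) + (\<Sum>k\<in>UNIV. \<nu> $ k * (h x $ k - h x0 $ k))"
      using lam \<mu> cvf cvg unfolding cvh
      by (intro add_mono sum_mono mult_left_mono order_refl) (auto intro: less_imp_le)
    \<comment> \<open>Complementarity removes the terms with \<open>g x0\<close>, and feasibility of
      both points removes those with \<open>h\<close>.\<close>
    also have "\<dots> = (\<Sum>i\<in>UNIV. lam $ i * (f x $ i - s $ i * F x $ i)) + (\<Sum>j\<in>UNIV. \<mu> $ j * g x $ j)"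
      using compl by (simp add: hx hx0 right_diff_distrib sum_subtractf)
    also have "\<dots> \<le> (\<Sum>i\<in>UNIV. lam $ i * (f x $ i - s $ i * F x $ i))"
      using \<mu> gx by (simp add: sum_nonpos mult_nonneg_nonpos)
    \<comment> \<open>Multiplying the ratio inequalities by \<open>F x $ i > 0\<close> makes every
      term nonpositive; strict positivity of \<open>lam\<close> keeps the improvement in component
      \<open>i0\<close> strict.\<close>
    also have "\<dots> < (\<Sum>i\<in>(UNIV :: 'p set). 0)"
    proof (rule sum_strict_mono_ex1)
      have "f x $ i - s $ i * F x $ i \<le> 0" for i
        using le[of i] F_pos[OF xU, of i] s by (simp add: pos_divide_le_eq)
      then show "\<forall>i\<in>UNIV. lam $ i * (f x $ i - s $ i * F x $ i) \<le> 0"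
        using lam by (simp add: mult_nonneg_nonpos less_imp_le)
      have "f x $ i0 - s $ i0 * F x $ i0 < 0"
        using less F_pos[OF xU, of i0] s by (simp add: pos_divide_less_eq)
      then show "\<exists>i\<in>UNIV. lam $ i * (f x $ i - s $ i * F x $ i) < 0"
        using lam by (meson UNIV_I mult_pos_neg)
    qed simp
    finally show False
      by simp
  qed
  then show ?thesis
    using feas unfolding pareto_efficient_def by blast
qed

end
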